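(* For all integers $n>2$ and $k>3$, not all $n$-qubit gates in $\mathcal{C}_k$ are semi-Clifford; that is, there exists an $n$-qubit gate $U\in\mathcal{C}_k$ which is not a semi-Clifford operation.
   Context: An $n$-qubit gate is a unitary operator on $(\mathbb{C}^2)^{\otimes n}$. The $n$-qubit Pauli group $\mathcal{P}_n$ is the group of order $4^{n+1}$ of all operators $c\,\sigma_1\otimes\cdots\otimes\sigma_n$ with $c\in\{\pm1,\pm i\}$ and $\sigma_j\in\{I,X,Y,Z\}$ (the identity and the Pauli matrices). The sets $\mathcal{C}_k$ (for fixed $n$) are defined recursively as sets of $n$-qubit unitaries: $\mathcal{C}_1=\mathcal{P}_n$ and $\mathcal{C}_{k+1}=\{U : U\mathcal{C}_1U^{\dagger}\subseteq\mathcal{C}_k\}$ for $k\ge 1$. An $n$-qubit unitary $U$ is called semi-Clifford if there is at least one maximal abelian subgroup $G$ of $\mathcal{P}_n$ such that $UGU^{\dagger}$ is a maximal abelian subgroup of $\mathcal{P}_n$ (possibly equal to $G$). *)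

theory Defs
  imports "Jordan_Normal_Form.Schur_Decomposition"
begin

text \<open>Operators on the \<open>n\<close>-fold tensor power of \<open>\<complex>\<^sup>2\<close> are complex matrices of dimension \<open>2 ^ n\<close>,
  written in the computational basis. The leftmost tensor factor is the most significant bit of
  a row or column index.\<close>

definition kronecker :: "'a :: semiring_0 mat \<Rightarrow> 'a mat \<Rightarrow> 'a mat" (infixr "\<Otimes>" 70) where
  "A \<Otimes> B = mat (dim_row A * dim_row B) (dim_col A * dim_col B)
     (\<lambda>(i, j). A $$ (i div dim_row B, j div dim_col B) * B $$ (i mod dim_row B, j mod dim_col B))"

definition qubit_gates :: "nat \<Rightarrow> complex mat set" where
  "qubit_gates n = {U \<in> carrier_mat (2 ^ n) (2 ^ n).
     mat_adjoint U * U = 1\<^sub>m (2 ^ n) \<and> U * mat_adjoint U = 1\<^sub>m (2 ^ n)}"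

definition pauli_X :: "complex mat" where
  "pauli_X = mat_of_rows_list 2 [[0, 1], [1, 0]]"

definition pauli_Y :: "complex mat" where
  "pauli_Y = mat_of_rows_list 2 [[0, - \<i>], [\<i>, 0]]"

definition pauli_Z :: "complex mat" where
  "pauli_Z = mat_of_rows_list 2 [[1, 0], [0, - 1]]"

text \<open>The fold ends in the \<open>1 \<times> 1\<close> identity matrix, which is neutral for \<^const>\<open>kronecker\<close>.\<close>

definition pauli_operators :: "nat \<Rightarrow> complex mat set" where
  "pauli_operators n = {c \<cdot>\<^sub>m foldr (\<Otimes>) ss (1\<^sub>m 1) | c ss.
     c \<in> {1, - 1, \<i>, - \<i>} \<and> length ss = n \<and> set ss \<subseteq> {1\<^sub>m 2, pauli_X, pauli_Y, pauli_Z}}"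

definition pauli_group :: "nat \<Rightarrow> complex mat monoid" where
  "pauli_group n = \<lparr>carrier = pauli_operators n, monoid.mult = (*), one = 1\<^sub>m (2 ^ n)\<rparr>"

definition conj_by :: "complex mat \<Rightarrow> complex mat \<Rightarrow> complex mat" where
  "conj_by U A = U * A * mat_adjoint U"

text \<open>The hierarchy starts at level 1; the value at level 0 is a dummy.\<close>

fun clifford_hierarchy :: "nat \<Rightarrow> nat \<Rightarrow> complex mat set" where
  "clifford_hierarchy n 0 = {}"
| "clifford_hierarchy n (Suc 0) = carrier (pauli_group n)"
| "clifford_hierarchy n (Suc (Suc k)) =
     {U \<in> qubit_gates n. conj_by U ` clifford_hierarchy n (Suc 0) \<subseteq> clifford_hierarchy n (Suc k)}"

definition abelian_subgroup :: "'a set \<Rightarrow> ('a, 'b) monoid_scheme \<Rightarrow> bool" where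
  "abelian_subgroup H G \<longleftrightarrow> subgroup H G \<and> comm_group (G\<lparr>carrier := H\<rparr>)"

definition maximal_abelian_subgroup :: "'a set \<Rightarrow> ('a, 'b) monoid_scheme \<Rightarrow> bool" where
  "maximal_abelian_subgroup H G \<longleftrightarrow>
     abelian_subgroup H G \<and> (\<forall>K. abelian_subgroup K G \<and> H \<subseteq> K \<longrightarrow> K = H)"

definition semi_clifford :: "nat \<Rightarrow> complex mat \<Rightarrow> bool" where
  "semi_clifford n U \<longleftrightarrow> U \<in> qubit_gates n \<and>
     (\<exists>G. maximal_abelian_subgroup G (pauli_group n) \<and>
          maximal_abelian_subgroup (conj_by U ` G) (pauli_group n))"

end

(*
  The gate U sends |x> to i^(x_0 y_2) |y>, where y is the image of x under the Toffoli gate that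
  flips bit 2 if bits 0 and 1 are set. Conjugating a Pauli operator by U gives an affine
  permutation of the basis times a phase that becomes a Pauli phase after two discrete derivatives,
  so U lies in C_4, hence in every C_k with k > 3 because the hierarchy is increasing.
  On the other hand, a Pauli operator P with U P U* again Pauli must commute with Z on bit 2:
  otherwise U P U* is not a translation of the basis up to signs. So a maximal abelian subgroup
  carried into the Pauli group by U would contain Z on bit 2, whose conjugate
  is Z on bit 2 times a controlled Z and hence not Pauli.
*)

theory Submission
  imports Defs "HOL-Algebra.Generated_Groups"
begin

unbundle bit_operations_syntax

section \<open>Characters and Pauli phases\<close>

definition unit_phases :: "complex set" where
  "unit_phases = {1, - 1, \<i>, - \<i>}"

lemma unit_phases_mult: "a \<in> unit_phases \<Longrightarrow> b \<in> unit_phases \<Longrightarrow> a * b \<in> unit_phases"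
  by (auto simp: unit_phases_def)

lemma unit_phases_cnj: "a \<in> unit_phases \<Longrightarrow> cnj a \<in> unit_phases"
  by (auto simp: unit_phases_def)

lemma unit_phases_mult_cnj: "a \<in> unit_phases \<Longrightarrow> a * cnj a = 1"
  by (auto simp: unit_phases_def)

text \<open>Characters and phases are functions on all natural numbers, regarded as a group under
  bitwise exclusive or; a matrix only reads their values below \<open>2 ^ n\<close>.\<close>

definition character :: "(nat \<Rightarrow> complex) \<Rightarrow> bool" where
  "character \<chi> \<longleftrightarrow> (\<forall>x y. \<chi> (x XOR y) = \<chi> x * \<chi> y) \<and> range \<chi> \<subseteq> {1, - 1}"

lemma character_xor: "character \<chi> \<Longrightarrow> \<chi> (x XOR y) = \<chi> x * \<chi> y"
  by (simp add: character_def)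

lemma character_cases: "character \<chi> \<Longrightarrow> \<chi> x = 1 \<or> \<chi> x = - 1"
  unfolding character_def by blast

lemma character_cnj [simp]: "character \<chi> \<Longrightarrow> cnj (\<chi> x) = \<chi> x"
  using character_cases[of \<chi> x] by auto

lemma character_square [simp]: "character \<chi> \<Longrightarrow> \<chi> x * \<chi> x = 1"
  using character_cases[of \<chi> x] by auto

lemma character_zero [simp]: "character \<chi> \<Longrightarrow> \<chi> 0 = 1"
  using character_xor[of \<chi> 0 0] character_cases[of \<chi> 0] by auto

lemma character_unit_phase: "character \<chi> \<Longrightarrow> \<chi> x \<in> unit_phases"
  using character_cases[of \<chi> x] by (auto simp: unit_phases_def)

lemma character_one: "character (\<lambda>x. 1)"
  by (simp add: character_def)

lemma character_mult:
  assumes "character \<chi>" "character \<psi>" shows "character (\<lambda>x. \<chi> x * \<psi> x)"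
proof -
  have "\<chi> x * \<psi> x \<in> {1, - 1}" for x
    using character_cases[OF assms(1), of x] character_cases[OF assms(2), of x] by auto
  then show ?thesis
    using assms unfolding character_def by (simp add: image_subset_iff)
qed

lemma character_comp:
  "character \<chi> \<Longrightarrow> (\<And>x y. h (x XOR y) = h x XOR h y) \<Longrightarrow> character (\<lambda>x. \<chi> (h x))"
  unfolding character_def by (auto simp: image_subset_iff)

text \<open>The factors by which a Pauli operator multiplies basis vectors: Z and Y factors
  contribute the character, Y factors and the scalar the root of unity.\<close>

definition pauli_phases :: "(nat \<Rightarrow> complex) set" where
  "pauli_phases = {\<lambda>x. \<alpha> * \<chi> x | \<alpha> \<chi>. \<alpha> \<in> unit_phases \<and> character \<chi>}"

lemma pauli_phasesI:
  "\<alpha> \<in> unit_phases \<Longrightarrow> character \<chi> \<Longrightarrow> (\<And>x. f x = \<alpha> * \<chi> x) \<Longrightarrow> f \<in> pauli_phases"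
  unfolding pauli_phases_def by blast

lemma pauli_phasesE:
  assumes "f \<in> pauli_phases"
  obtains \<alpha> \<chi> where "\<alpha> \<in> unit_phases" "character \<chi>" "f = (\<lambda>x. \<alpha> * \<chi> x)"
  using assms unfolding pauli_phases_def by blast

lemma pauli_phases_mult:
  assumes "f \<in> pauli_phases" "g \<in> pauli_phases"
  shows "(\<lambda>x. f x * g x) \<in> pauli_phases"
proof -
  obtain \<alpha> \<chi> \<beta> \<psi> where "\<alpha> \<in> unit_phases" "character \<chi>" "f = (\<lambda>x. \<alpha> * \<chi> x)"
      "\<beta> \<in> unit_phases" "character \<psi>" "g = (\<lambda>x. \<beta> * \<psi> x)"
    using assms by (metis pauli_phasesE)
  then show ?thesis
    by (intro pauli_phasesI[of "\<alpha> * \<beta>" "\<lambda>x. \<chi> x * \<psi> x"])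
      (auto simp: unit_phases_mult character_mult)
qed

lemma pauli_phases_const: "\<alpha> \<in> unit_phases \<Longrightarrow> (\<lambda>x. \<alpha>) \<in> pauli_phases"
  by (rule pauli_phasesI[OF _ character_one]) auto

lemma pauli_phases_xor:
  assumes "f \<in> pauli_phases" shows "(\<lambda>x. f (x XOR u)) \<in> pauli_phases"
  using assms by (elim pauli_phasesE)
    (rule pauli_phasesI[where \<alpha> = "_ * _ u"], auto simp: unit_phases_mult character_unit_phase character_xor)

lemma pauli_phases_cnj:
  assumes "f \<in> pauli_phases" shows "(\<lambda>x. cnj (f x)) \<in> pauli_phases"
  using assms by (elim pauli_phasesE) (rule pauli_phasesI, auto simp: unit_phases_cnj)

lemma pauli_phases_mult_cnj:
  assumes "f \<in> pauli_phases" shows "f x * cnj (f x) = 1"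
proof -
  obtain \<alpha> \<chi> where f: "\<alpha> \<in> unit_phases" "character \<chi>" "f = (\<lambda>x. \<alpha> * \<chi> x)"
    using assms by (rule pauli_phasesE)
  then have "f x * cnj (f x) = (\<alpha> * cnj \<alpha>) * (\<chi> x * \<chi> x)" by simp
  with f show ?thesis by (simp add: unit_phases_mult_cnj)
qed

section \<open>Monomial matrices\<close>

text \<open>The operator sending |j> to \<open>f j\<close> times |\<pi> j>; the phase is read at the
  column, that is, at the input.\<close>

definition monomial_mat :: "nat \<Rightarrow> (nat \<Rightarrow> nat) \<Rightarrow> (nat \<Rightarrow> complex) \<Rightarrow> complex mat" where
  "monomial_mat n \<pi> f = mat (2 ^ n) (2 ^ n) (\<lambda>(i, j). if i = \<pi> j then f j else 0)"

lemma monomial_mat_carrier [simp]: "monomial_mat n \<pi> f \<in> carrier_mat (2 ^ n) (2 ^ n)"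
  by (simp add: monomial_mat_def)

lemma monomial_mat_dim [simp]:
  "dim_row (monomial_mat n \<pi> f) = 2 ^ n" "dim_col (monomial_mat n \<pi> f) = 2 ^ n"
  by (simp_all add: monomial_mat_def)

lemma monomial_mat_index [simp]:
  "i < 2 ^ n \<Longrightarrow> j < 2 ^ n \<Longrightarrow> monomial_mat n \<pi> f $$ (i, j) = (if i = \<pi> j then f j else 0)"
  by (simp add: monomial_mat_def)

lemma monomial_mat_cong:
  "(\<And>j. j < 2 ^ n \<Longrightarrow> \<pi> j = \<rho> j) \<Longrightarrow> (\<And>j. j < 2 ^ n \<Longrightarrow> f j = g j) \<Longrightarrow>
   monomial_mat n \<pi> f = monomial_mat n \<rho> g"
  by (rule eq_matI) auto

text \<open>Column \<open>j\<close> has a nonzero entry in row \<open>\<pi> j\<close>, so the other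
  matrix must have its entry there too. The last two hypotheses ensure that this entry lies in the
  matrix and does not vanish.\<close>

lemma monomial_mat_eqD:
  assumes "monomial_mat n \<pi> f = monomial_mat n \<rho> g"
    and "j < 2 ^ n" "\<pi> j < 2 ^ n" "f j \<noteq> 0"
  shows "\<pi> j = \<rho> j" "f j = g j"
proof -
  have "monomial_mat n \<rho> g $$ (\<pi> j, j) = f j"
    using assms by (simp flip: assms(1))
  then show "\<pi> j = \<rho> j" "f j = g j"
    using assms by (auto split: if_splits)
qed

lemma monomial_mat_mult:
  assumes "\<And>j. j < 2 ^ n \<Longrightarrow> \<rho> j < 2 ^ n"
  shows "monomial_mat n \<pi> f * monomial_mat n \<rho> g =
    monomial_mat n (\<lambda>j. \<pi> (\<rho> j)) (\<lambda>j. f (\<rho> j) * g j)"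
proof (rule eq_matI)
  fix i j assume "i < dim_row (monomial_mat n (\<lambda>j. \<pi> (\<rho> j)) (\<lambda>j. f (\<rho> j) * g j))"
    and "j < dim_col (monomial_mat n (\<lambda>j. \<pi> (\<rho> j)) (\<lambda>j. f (\<rho> j) * g j))"
  then have ij: "i < 2 ^ n" "j < 2 ^ n" by simp_all
  have "(monomial_mat n \<pi> f * monomial_mat n \<rho> g) $$ (i, j) =
      (\<Sum>l\<in>{0..<2 ^ n}. (if i = \<pi> l then f l else 0) * (if l = \<rho> j then g j else 0))"
    using ij by (simp add: scalar_prod_def)
  also have "\<dots> = (\<Sum>l\<in>{0..<2 ^ n}. if l = \<rho> j then (if i = \<pi> (\<rho> j) then f (\<rho> j) * g j else 0) else 0)"
    by (rule sum.cong) auto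
  finally show "(monomial_mat n \<pi> f * monomial_mat n \<rho> g) $$ (i, j) =
      monomial_mat n (\<lambda>j. \<pi> (\<rho> j)) (\<lambda>j. f (\<rho> j) * g j) $$ (i, j)"
    using ij assms by simp
qed auto

lemma one_mat_eq_monomial_mat: "1\<^sub>m (2 ^ n) = monomial_mat n (\<lambda>j. j) (\<lambda>j. 1)"
  by (rule eq_matI) auto

lemma smult_monomial_mat: "c \<cdot>\<^sub>m monomial_mat n \<pi> f = monomial_mat n \<pi> (\<lambda>j. c * f j)"
  by (rule eq_matI) auto

text \<open>All permutations that occur (translations, the Toffoli map, conjugates of translations
  by it) are their own inverses, so the adjoint of a monomial matrix can reuse \<pi>.\<close>

definition index_involution :: "nat \<Rightarrow> (nat \<Rightarrow> nat) \<Rightarrow> bool" where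
  "index_involution n \<pi> \<longleftrightarrow> (\<forall>x. \<pi> (\<pi> x) = x) \<and> (\<forall>x < 2 ^ n. \<pi> x < 2 ^ n)"

lemma nat_xor_less: "x < 2 ^ n \<Longrightarrow> y < 2 ^ n \<Longrightarrow> x XOR y < 2 ^ n" for x y :: nat
  by (metis take_bit_nat_eq_self take_bit_xor take_bit_nat_less_exp)

lemma xor_cancel_right [simp]: "(x XOR u) XOR u = x" for x u :: nat
  by (simp add: xor.assoc)

lemma index_involution_xor: "u < 2 ^ n \<Longrightarrow> index_involution n (\<lambda>j. j XOR u)"
  by (simp add: index_involution_def nat_xor_less)

section \<open>Adjoints and conjugation of monomial matrices\<close>

lemma mat_adjoint_index:
  "A \<in> carrier_mat m m \<Longrightarrow> i < m \<Longrightarrow> j < m \<Longrightarrow> mat_adjoint A $$ (i, j) = conjugate (A $$ (j, i))"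
  by (auto simp: mat_adjoint_def mat_of_rows_index)

lemma mat_adjoint_carrier: "A \<in> carrier_mat m m \<Longrightarrow> mat_adjoint A \<in> carrier_mat m m"
  by (auto simp: mat_adjoint_def)

lemma mat_adjoint_monomial_mat:
  assumes "index_involution n \<pi>"
  shows "mat_adjoint (monomial_mat n \<pi> f) = monomial_mat n \<pi> (\<lambda>j. cnj (f (\<pi> j)))"
proof (rule eq_matI)
  fix i j assume "i < dim_row (monomial_mat n \<pi> (\<lambda>j. cnj (f (\<pi> j))))"
    and "j < dim_col (monomial_mat n \<pi> (\<lambda>j. cnj (f (\<pi> j))))"
  then have "i < 2 ^ n" "j < 2 ^ n" by simp_all
  moreover have "j = \<pi> i \<longleftrightarrow> i = \<pi> j"
    using assms by (auto simp: index_involution_def)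
  ultimately show "mat_adjoint (monomial_mat n \<pi> f) $$ (i, j) =
      monomial_mat n \<pi> (\<lambda>j. cnj (f (\<pi> j))) $$ (i, j)"
    using assms by (auto simp: mat_adjoint_index[of _ "2 ^ n"] index_involution_def)
qed (use mat_adjoint_carrier[of "monomial_mat n \<pi> f" "2 ^ n"] in auto)

lemma monomial_mat_gate:
  assumes "index_involution n \<pi>" "\<And>x. f x * cnj (f x) = 1"
  shows "monomial_mat n \<pi> f \<in> qubit_gates n"
  using assms
  by (auto simp: qubit_gates_def mat_adjoint_monomial_mat monomial_mat_mult index_involution_def
      one_mat_eq_monomial_mat mult.commute intro!: monomial_mat_cong)

text \<open>The index \<open>y\<close> is pulled back by \<pi>, translated by \<open>u\<close> and
  pushed forward again; each factor contributes its phase at the index it meets.\<close>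

lemma conj_by_monomial_mat:
  assumes "index_involution n \<pi>" "u < 2 ^ n"
  shows "conj_by (monomial_mat n \<pi> f) (monomial_mat n (\<lambda>j. j XOR u) h) =
    monomial_mat n (\<lambda>y. \<pi> (\<pi> y XOR u)) (\<lambda>y. f (\<pi> y XOR u) * h (\<pi> y) * cnj (f (\<pi> y)))"
  using assms
  by (simp add: conj_by_def mat_adjoint_monomial_mat monomial_mat_mult index_involution_def
      nat_xor_less)

section \<open>Kronecker products of monomial matrices\<close>

lemma kronecker_monomial_mat:
  assumes "\<And>j. j < 2 ^ n \<Longrightarrow> \<rho> j < 2 ^ n"
  shows "monomial_mat m \<pi> f \<Otimes> monomial_mat n \<rho> g =
    monomial_mat (m + n) (\<lambda>j. \<pi> (j div 2 ^ n) * 2 ^ n + \<rho> (j mod 2 ^ n))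
      (\<lambda>j. f (j div 2 ^ n) * g (j mod 2 ^ n))"
    (is "?L = monomial_mat _ ?\<sigma> ?h")
proof (rule eq_matI)
  fix i j assume "i < dim_row (monomial_mat (m + n) ?\<sigma> ?h)" "j < dim_col (monomial_mat (m + n) ?\<sigma> ?h)"
  then have ij: "i < 2 ^ m * 2 ^ n" "j < 2 ^ m * 2 ^ n" by (simp_all add: power_add)
  then have d: "i div 2 ^ n < 2 ^ m" "j div 2 ^ n < 2 ^ m"
    by (simp_all add: less_mult_imp_div_less)
  \<comment> \<open>This bound excludes a carry into the high part, so quotient and remainder by
    \<open>2 ^ n\<close> recover both summands.\<close>
  have "\<rho> (j mod 2 ^ n) < 2 ^ n" by (rule assms) simp
  then have "i = ?\<sigma> j \<longleftrightarrow> i div 2 ^ n = \<pi> (j div 2 ^ n) \<and> i mod 2 ^ n = \<rho> (j mod 2 ^ n)"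
    by (metis div_mult_mod_eq div_mult_self3 div_less mod_mult_self3 mod_less add_0_right
        power_not_zero zero_neq_numeral)
  with ij d show "?L $$ (i, j) = monomial_mat (m + n) ?\<sigma> ?h $$ (i, j)"
    by (auto simp: kronecker_def power_add)
qed (auto simp: kronecker_def power_add)

lemma kronecker_smult:
  fixes a b :: "'a :: comm_semiring_0"
  shows "(a \<cdot>\<^sub>m A) \<Otimes> (b \<cdot>\<^sub>m B) = (a * b) \<cdot>\<^sub>m (A \<Otimes> B)"
proof (rule eq_matI)
  fix i j assume "i < dim_row ((a * b) \<cdot>\<^sub>m (A \<Otimes> B))" "j < dim_col ((a * b) \<cdot>\<^sub>m (A \<Otimes> B))"
  then have ij: "i < dim_row A * dim_row B" "j < dim_col A * dim_col B"
    by (simp_all add: kronecker_def)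
  then have "dim_row B \<noteq> 0" "dim_col B \<noteq> 0" by (metis mult_0_right not_less_zero)+
  with ij show "((a \<cdot>\<^sub>m A) \<Otimes> (b \<cdot>\<^sub>m B)) $$ (i, j) = ((a * b) \<cdot>\<^sub>m (A \<Otimes> B)) $$ (i, j)"
    by (simp add: kronecker_def less_mult_imp_div_less ac_simps)
qed (auto simp: kronecker_def)

text \<open>Exclusive or acts separately on the low \<open>n\<close> bits and on the rest, and
  \<open>u * 2 ^ n + v\<close> concatenates \<open>u\<close> with the \<open>n\<close>-bit word
  \<open>v\<close>. Translations on tensor factors thus combine into one.\<close>

lemma xor_split:
  fixes j u v :: nat
  assumes "v < 2 ^ n"
  shows "(j div 2 ^ n XOR u) * 2 ^ n + (j mod 2 ^ n XOR v) = j XOR (u * 2 ^ n + v)"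
proof -
  have "drop_bit n (j XOR (u * 2 ^ n + v)) = j div 2 ^ n XOR u"
    and "take_bit n (j XOR (u * 2 ^ n + v)) = j mod 2 ^ n XOR v"
    using assms
    by (simp_all only: drop_bit_xor take_bit_xor) (simp_all add: drop_bit_eq_div take_bit_eq_mod)
  then show ?thesis
    using div_mult_mod_eq[of "j XOR (u * 2 ^ n + v)" "2 ^ n"]
    by (simp only: drop_bit_eq_div take_bit_eq_mod)
qed

lemma div_power_xor: "(x XOR y) div 2 ^ n = x div 2 ^ n XOR y div 2 ^ n" for x y :: nat
  by (simp flip: drop_bit_eq_div)

lemma mod_power_xor: "(x XOR y) mod 2 ^ n = x mod 2 ^ n XOR y mod 2 ^ n" for x y :: nat
  by (simp flip: take_bit_eq_mod)

section \<open>Pauli operators as monomial matrices\<close>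

abbreviation pauli_matrices :: "complex mat set" where
  "pauli_matrices \<equiv> {1\<^sub>m 2, pauli_X, pauli_Y, pauli_Z}"

lemma less_two_cases: "i < 2 \<Longrightarrow> i = 0 \<or> i = Suc 0" for i :: nat
  by auto

lemma character_parity: "character (\<lambda>x. if odd x then - 1 else 1)"
  by (auto simp: character_def even_xor_iff)

text \<open>X translates by 1, Z is the parity character, and Y = iXZ. The translation by 0 is
  written out so that all four have the shape of a general Pauli operator.\<close>

lemma pauli_matrices_monomial:
  "1\<^sub>m 2 = monomial_mat 1 (\<lambda>j. j XOR 0) (\<lambda>j. 1)"
  "pauli_Z = monomial_mat 1 (\<lambda>j. j XOR 0) (\<lambda>j. if odd j then - 1 else 1)"
  "pauli_X = monomial_mat 1 (\<lambda>j. j XOR 1) (\<lambda>j. 1)"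
  "pauli_Y = monomial_mat 1 (\<lambda>j. j XOR 1) (\<lambda>j. \<i> * (if odd j then - 1 else 1))"
  by (rule eq_matI; auto simp: pauli_X_def pauli_Y_def pauli_Z_def mat_of_rows_list_def dest!: less_two_cases)+

lemma pauli_matrix_monomialE:
  assumes "s \<in> pauli_matrices"
  obtains u f where "u < 2" "f \<in> pauli_phases" "s = monomial_mat 1 (\<lambda>j. j XOR u) f"
proof -
  have one: "(\<lambda>j. 1) \<in> pauli_phases"
    by (rule pauli_phases_const) (simp add: unit_phases_def)
  have sign: "(\<lambda>j. if odd j then - 1 else 1) \<in> pauli_phases"
    by (rule pauli_phasesI[OF _ character_parity, of 1]) (auto simp: unit_phases_def)
  have i_sign: "(\<lambda>j. \<i> * (if odd j then - 1 else 1)) \<in> pauli_phases"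
    by (rule pauli_phasesI[OF _ character_parity, of \<i>]) (auto simp: unit_phases_def)
  from assms consider "s = 1\<^sub>m 2" | "s = pauli_X" | "s = pauli_Y" | "s = pauli_Z" by blast
  then show thesis
  proof cases
    case 1
    show thesis by (rule that[OF _ one, of 0]) (auto simp: 1 pauli_matrices_monomial)
  next
    case 2
    show thesis by (rule that[OF _ one, of 1]) (auto simp: 2 pauli_matrices_monomial)
  next
    case 3
    show thesis by (rule that[OF _ i_sign, of 1]) (auto simp: 3 pauli_matrices_monomial)
  next
    case 4
    show thesis by (rule that[OF _ sign, of 0]) (auto simp: 4 pauli_matrices_monomial)
  qed
qed

text \<open>The possible shifts and signs give I, Z, X and XZ. The hypotheses concern the values at
  0 and 1, all that a 2 by 2 matrix reads; this suits the restriction of a character to the top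
  bit.\<close>

lemma monomial_pauli_matrixE:
  assumes "u < 2" "\<chi> 0 = 1" "\<chi> 1 = 1 \<or> \<chi> 1 = - 1"
  obtains c s where "c \<in> unit_phases" "s \<in> pauli_matrices"
    "monomial_mat 1 (\<lambda>j. j XOR u) \<chi> = c \<cdot>\<^sub>m s"
proof -
  have u: "u = 0 \<or> u = 1" using assms(1) by auto
  have "\<exists>c s. c \<in> unit_phases \<and> s \<in> pauli_matrices \<and> monomial_mat 1 (\<lambda>j. j XOR u) \<chi> = c \<cdot>\<^sub>m s"
    using u assms(3)
  proof (elim disjE)
    assume "u = 0" "\<chi> 1 = 1"
    then have "monomial_mat 1 (\<lambda>j. j XOR u) \<chi> = 1 \<cdot>\<^sub>m 1\<^sub>m 2"
      unfolding pauli_matrices_monomial smult_monomial_mat using assms(2)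
      by (auto intro!: monomial_mat_cong dest!: less_two_cases)
    then show ?thesis by (auto simp: unit_phases_def)
  next
    assume "u = 0" "\<chi> 1 = - 1"
    then have "monomial_mat 1 (\<lambda>j. j XOR u) \<chi> = 1 \<cdot>\<^sub>m pauli_Z"
      unfolding pauli_matrices_monomial smult_monomial_mat using assms(2)
      by (auto intro!: monomial_mat_cong dest!: less_two_cases)
    then show ?thesis by (auto simp: unit_phases_def)
  next
    assume "u = 1" "\<chi> 1 = 1"
    then have "monomial_mat 1 (\<lambda>j. j XOR u) \<chi> = 1 \<cdot>\<^sub>m pauli_X"
      unfolding pauli_matrices_monomial smult_monomial_mat using assms(2)
      by (auto intro!: monomial_mat_cong dest!: less_two_cases)
    then show ?thesis by (auto simp: unit_phases_def)
  next
    assume "u = 1" "\<chi> 1 = - 1"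
    \<comment> \<open>XZ = -iY.\<close>
    then have "monomial_mat 1 (\<lambda>j. j XOR u) \<chi> = (- \<i>) \<cdot>\<^sub>m pauli_Y"
      unfolding pauli_matrices_monomial smult_monomial_mat using assms(2)
      by (auto intro!: monomial_mat_cong dest!: less_two_cases)
    then show ?thesis by (auto simp: unit_phases_def)
  qed
  then show thesis using that by blast
qed

text \<open>Prepending a factor makes its shift the new top bit. Characters stay characters after
  quotient and remainder by \<open>2 ^ n\<close>, since both maps respect exclusive or.\<close>

lemma foldr_kronecker_monomial:
  "set ss \<subseteq> pauli_matrices \<Longrightarrow> \<exists>u f. u < 2 ^ length ss \<and> f \<in> pauli_phases \<and>
     foldr (\<Otimes>) ss (1\<^sub>m 1) = monomial_mat (length ss) (\<lambda>j. j XOR u) f"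
proof (induction ss)
  case Nil
  have "(\<lambda>j. 1) \<in> pauli_phases"
    by (rule pauli_phases_const) (simp add: unit_phases_def)
  moreover have "1\<^sub>m 1 = monomial_mat 0 (\<lambda>j. j XOR 0) (\<lambda>j. 1)"
    using one_mat_eq_monomial_mat[of 0] by simp
  ultimately show ?case by auto
next
  case (Cons s ss)
  define n where "n = length ss"
  obtain v g where v: "v < 2 ^ n" "g \<in> pauli_phases"
      "foldr (\<Otimes>) ss (1\<^sub>m 1) = monomial_mat n (\<lambda>j. j XOR v) g"
    using Cons by (auto simp: n_def)
  obtain u f where u: "u < 2" "f \<in> pauli_phases" "s = monomial_mat 1 (\<lambda>j. j XOR u) f"
    using Cons.prems pauli_matrix_monomialE[of s] by (metis list.set_intros(1) subset_iff)
  obtain \<alpha> \<chi> where f: "\<alpha> \<in> unit_phases" "character \<chi>" "f = (\<lambda>x. \<alpha> * \<chi> x)"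
    using u(2) by (rule pauli_phasesE)
  obtain \<beta> \<psi> where g: "\<beta> \<in> unit_phases" "character \<psi>" "g = (\<lambda>x. \<beta> * \<psi> x)"
    using v(2) by (rule pauli_phasesE)
  have "(\<lambda>j. f (j div 2 ^ n) * g (j mod 2 ^ n)) \<in> pauli_phases"
    by (rule pauli_phasesI[of "\<alpha> * \<beta>" "\<lambda>j. \<chi> (j div 2 ^ n) * \<psi> (j mod 2 ^ n)"])
      (use f g in \<open>auto intro!: unit_phases_mult character_mult character_comp[where \<chi> = \<chi>]
          character_comp[where \<chi> = \<psi>] simp: div_power_xor mod_power_xor\<close>)
  moreover have "foldr (\<Otimes>) (s # ss) (1\<^sub>m 1) =
      monomial_mat (Suc n) (\<lambda>j. j XOR (u * 2 ^ n + v)) (\<lambda>j. f (j div 2 ^ n) * g (j mod 2 ^ n))"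
    using v u by (simp add: kronecker_monomial_mat nat_xor_less xor_split)
  moreover have "u * 2 ^ n + v < 2 ^ Suc n"
    using u(1) v(1) by (cases u) auto
  ultimately show ?case unfolding n_def by auto
qed

text \<open>A character is the product of its restrictions to the top bit and to the lower bits, so
  a one-qubit factor splits off.\<close>

lemma monomial_foldr_kronecker:
  "u < 2 ^ n \<Longrightarrow> f \<in> pauli_phases \<Longrightarrow> \<exists>c ss. c \<in> unit_phases \<and> length ss = n \<and>
     set ss \<subseteq> pauli_matrices \<and> monomial_mat n (\<lambda>j. j XOR u) f = c \<cdot>\<^sub>m foldr (\<Otimes>) ss (1\<^sub>m 1)"
proof (induction n arbitrary: u)
  case 0
  obtain \<alpha> \<chi> where f: "\<alpha> \<in> unit_phases" "character \<chi>" "f = (\<lambda>x. \<alpha> * \<chi> x)"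
    using 0(2) by (rule pauli_phasesE)
  have "monomial_mat 0 (\<lambda>j. j XOR u) f = \<alpha> \<cdot>\<^sub>m foldr (\<Otimes>) [] (1\<^sub>m 1)"
    using f 0 by (auto intro!: eq_matI)
  then show ?case using f(1) by (intro exI[of _ \<alpha>] exI[of _ "[]"]) auto
next
  case (Suc n)
  obtain \<alpha> \<chi> where f: "\<alpha> \<in> unit_phases" "character \<chi>" "f = (\<lambda>x. \<alpha> * \<chi> x)"
    using Suc(3) by (rule pauli_phasesE)
  obtain c ss where c: "c \<in> unit_phases" "length ss = n" "set ss \<subseteq> pauli_matrices"
      "monomial_mat n (\<lambda>j. j XOR (u mod 2 ^ n)) f = c \<cdot>\<^sub>m foldr (\<Otimes>) ss (1\<^sub>m 1)"
    using Suc.IH[of "u mod 2 ^ n"] Suc.prems by auto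
  have u: "u div 2 ^ n < 2" using Suc.prems(1) by (simp add: less_mult_imp_div_less)
  \<comment> \<open>The top-bit factor uses \<chi> alone; the constant \<alpha> stays with the lower
    bits, inside \<open>f\<close>.\<close>
  obtain d s where d: "d \<in> unit_phases" "s \<in> pauli_matrices"
      "monomial_mat 1 (\<lambda>j. j XOR (u div 2 ^ n)) (\<lambda>j. \<chi> (j * 2 ^ n)) = d \<cdot>\<^sub>m s"
    using monomial_pauli_matrixE[OF u, of "\<lambda>j. \<chi> (j * 2 ^ n)"] f(2) character_cases[of \<chi> "2 ^ n"]
    by (metis (no_types, lifting) character_zero mult_1 mult_zero_left)
  have split: "\<chi> (j div 2 ^ n * 2 ^ n) * \<chi> (j mod 2 ^ n) = \<chi> j" for j
  proof -
    have "j mod 2 ^ n XOR j div 2 ^ n * 2 ^ n = j"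
      using xor_split[of 0 n "j mod 2 ^ n" "j div 2 ^ n"] div_mult_mod_eq[of j "2 ^ n"]
      by (simp add: xor.commute)
    then show ?thesis
      using character_xor[OF f(2), of "j mod 2 ^ n" "j div 2 ^ n * 2 ^ n"] by (simp add: mult.commute)
  qed
  have "monomial_mat (Suc n) (\<lambda>j. j XOR u) f =
      monomial_mat 1 (\<lambda>j. j XOR (u div 2 ^ n)) (\<lambda>j. \<chi> (j * 2 ^ n)) \<Otimes>
      monomial_mat n (\<lambda>j. j XOR (u mod 2 ^ n)) f"
    by (subst kronecker_monomial_mat)
      (auto intro!: monomial_mat_cong simp: nat_xor_less xor_split f(3) mult.left_commute split div_mult_mod_eq)
  also have "\<dots> = (d * c) \<cdot>\<^sub>m (s \<Otimes> foldr (\<Otimes>) ss (1\<^sub>m 1))"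
    unfolding c(4) d(3) by (rule kronecker_smult)
  finally show ?case
    using c d by (intro exI[of _ "d * c"] exI[of _ "s # ss"]) (auto intro: unit_phases_mult)
qed

text \<open>The normal form behind the later arguments: the X part of a Pauli operator is a
  translation of the basis, its Z part a Pauli phase.\<close>

lemma pauli_operators_eq:
  "pauli_operators n = {monomial_mat n (\<lambda>j. j XOR u) f | u f. u < 2 ^ n \<and> f \<in> pauli_phases}"
    (is "_ = ?M")
proof
  show "pauli_operators n \<subseteq> ?M"
  proof
    fix P assume "P \<in> pauli_operators n"
    then obtain c ss where c: "c \<in> unit_phases" "length ss = n" "set ss \<subseteq> pauli_matrices"
        "P = c \<cdot>\<^sub>m foldr (\<Otimes>) ss (1\<^sub>m 1)"
      unfolding pauli_operators_def unit_phases_def by blast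
    then obtain u f where f: "u < 2 ^ n" "f \<in> pauli_phases"
        "foldr (\<Otimes>) ss (1\<^sub>m 1) = monomial_mat n (\<lambda>j. j XOR u) f"
      using foldr_kronecker_monomial by blast
    have "(\<lambda>j. c * f j) \<in> pauli_phases"
      using pauli_phases_mult[OF pauli_phases_const f(2)] c(1) by blast
    then show "P \<in> ?M"
      using c(4) f by (auto simp: smult_monomial_mat)
  qed
  show "?M \<subseteq> pauli_operators n"
    using monomial_foldr_kronecker unfolding pauli_operators_def unit_phases_def by fastforce
qed

lemma pauli_operatorsE:
  assumes "P \<in> pauli_operators n"
  obtains u f where "u < 2 ^ n" "f \<in> pauli_phases" "P = monomial_mat n (\<lambda>j. j XOR u) f"
  using assms unfolding pauli_operators_eq by blast

lemma pauli_operatorsI: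
  "u < 2 ^ n \<Longrightarrow> f \<in> pauli_phases \<Longrightarrow> monomial_mat n (\<lambda>j. j XOR u) f \<in> pauli_operators n"
  unfolding pauli_operators_eq by blast

lemma pauli_operators_carrier_mat: "P \<in> pauli_operators n \<Longrightarrow> P \<in> carrier_mat (2 ^ n) (2 ^ n)"
  by (auto elim: pauli_operatorsE)

lemma pauli_operators_one: "1\<^sub>m (2 ^ n) \<in> pauli_operators n"
  using pauli_operatorsI[of 0 n "\<lambda>_. 1"] pauli_phases_const[of 1]
  by (simp add: one_mat_eq_monomial_mat unit_phases_def)

lemma pauli_operators_mult:
  assumes "P \<in> pauli_operators n" "Q \<in> pauli_operators n"
  shows "P * Q \<in> pauli_operators n"
proof -
  obtain u f where P: "u < 2 ^ n" "f \<in> pauli_phases" "P = monomial_mat n (\<lambda>j. j XOR u) f"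
    using assms(1) by (rule pauli_operatorsE)
  obtain v g where Q: "v < 2 ^ n" "g \<in> pauli_phases" "Q = monomial_mat n (\<lambda>j. j XOR v) g"
    using assms(2) by (rule pauli_operatorsE)
  have "P * Q = monomial_mat n (\<lambda>j. j XOR (v XOR u)) (\<lambda>j. f (j XOR v) * g j)"
    using P Q by (simp add: monomial_mat_mult nat_xor_less xor.assoc)
  also have "\<dots> \<in> pauli_operators n"
    using P Q by (intro pauli_operatorsI pauli_phases_mult pauli_phases_xor nat_xor_less)
  finally show ?thesis .
qed

lemma pauli_operators_adjoint:
  assumes "P \<in> pauli_operators n"
  shows "mat_adjoint P \<in> pauli_operators n"
  using assms
  by (elim pauli_operatorsE) (simp add: mat_adjoint_monomial_mat index_involution_xor
      pauli_operatorsI pauli_phases_cnj pauli_phases_xor)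

lemma pauli_operators_gates: "pauli_operators n \<subseteq> qubit_gates n"
  by (auto elim!: pauli_operatorsE intro!: monomial_mat_gate index_involution_xor pauli_phases_mult_cnj)

section \<open>The Pauli group and the growth of the hierarchy\<close>

lemma carrier_pauli_group [simp]: "carrier (pauli_group n) = pauli_operators n"
  by (simp add: pauli_group_def)

lemma mult_pauli_group [simp]: "P \<otimes>\<^bsub>pauli_group n\<^esub> Q = P * Q"
  by (simp add: pauli_group_def)

lemma group_pauli_group: "group (pauli_group n)"
proof (rule groupI)
  fix P assume "P \<in> carrier (pauli_group n)"
  then have "mat_adjoint P \<in> pauli_operators n" "mat_adjoint P * P = 1\<^sub>m (2 ^ n)"
    using pauli_operators_adjoint pauli_operators_gates by (auto simp: qubit_gates_def)
  then show "\<exists>Q \<in> carrier (pauli_group n). Q \<otimes>\<^bsub>pauli_group n\<^esub> P = \<one>\<^bsub>pauli_group n\<^esub>"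
    by (auto simp: pauli_group_def)
qed (auto simp: pauli_group_def pauli_operators_mult pauli_operators_one
    dest: pauli_operators_carrier_mat intro: assoc_mult_mat left_mult_one_mat)

text \<open>The Pauli group is closed under conjugation by its elements, and each inclusion enlarges
  the set in which conjugates must lie at the next level.\<close>

lemma clifford_hierarchy_Suc_mono:
  "clifford_hierarchy n (Suc k) \<subseteq> clifford_hierarchy n (Suc (Suc k))"
proof (induction k)
  case 0
  have "conj_by U P \<in> pauli_operators n" if "U \<in> pauli_operators n" "P \<in> pauli_operators n" for U P
    using that by (auto simp: conj_by_def intro: pauli_operators_mult pauli_operators_adjoint)
  then show ?case
    using pauli_operators_gates by auto
next
  case (Suc k)
  then show ?case by auto
qed

lemma clifford_hierarchy_mono:
  "k \<le> l \<Longrightarrow> clifford_hierarchy n k \<subseteq> clifford_hierarchy n l"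
proof (induction l rule: dec_induct)
  case (step l)
  moreover have "clifford_hierarchy n l \<subseteq> clifford_hierarchy n (Suc l)"
    using clifford_hierarchy_Suc_mono by (cases l) auto
  ultimately show ?case by blast
qed simp

section \<open>Phase functions and the Clifford hierarchy\<close>

text \<open>The multiplicative analogue of polynomials of bounded degree: each discrete derivative
  lowers the level by one.\<close>

fun phase_level :: "nat \<Rightarrow> (nat \<Rightarrow> complex) set" where
  "phase_level 0 = pauli_phases"
| "phase_level (Suc k) = {f. (\<forall>x. f x * cnj (f x) = 1) \<and>
     (\<forall>u. (\<lambda>x. f (x XOR u) * cnj (f x)) \<in> phase_level k)}"

lemma phase_level_mult_cnj: "f \<in> phase_level k \<Longrightarrow> f x * cnj (f x) = 1"
  by (cases k) (auto simp: pauli_phases_mult_cnj)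

text \<open>The discrete derivative of a product is the product of the derivatives.\<close>

lemma phase_level_mult:
  "f \<in> phase_level k \<Longrightarrow> g \<in> phase_level k \<Longrightarrow> (\<lambda>x. f x * g x) \<in> phase_level k"
proof (induction k arbitrary: f g)
  case (Suc k)
  have "(\<lambda>x. (f (x XOR u) * g (x XOR u)) * cnj (f x * g x)) \<in> phase_level k" for u
  proof -
    have "(\<lambda>x. (f (x XOR u) * cnj (f x)) * (g (x XOR u) * cnj (g x))) \<in> phase_level k"
      by (rule Suc.IH) (use Suc.prems in auto)
    then show ?thesis by (simp add: ac_simps)
  qed
  moreover have "(f x * g x) * cnj (f x * g x) = 1" for x
  proof -
    have "(f x * g x) * cnj (f x * g x) = (f x * cnj (f x)) * (g x * cnj (g x))"
      by (simp add: ac_simps)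
    also have "\<dots> = 1" using Suc.prems by simp
    finally show ?thesis .
  qed
  ultimately show ?case by simp
qed (simp add: pauli_phases_mult)

lemma phase_level_cnj: "f \<in> phase_level k \<Longrightarrow> (\<lambda>x. cnj (f x)) \<in> phase_level k"
proof (induction k arbitrary: f)
  case (Suc k)
  have "(\<lambda>x. cnj (f (x XOR u)) * cnj (cnj (f x))) \<in> phase_level k" for u
    using Suc.IH[of "\<lambda>x. f (x XOR u) * cnj (f x)"] Suc.prems by simp
  with Suc.prems show ?case by (simp add: mult.commute)
qed (simp add: pauli_phases_cnj)

text \<open>The derivative of \<open>\<alpha> * \<chi> x\<close> along \<open>u\<close> is the
  constant \<open>\<chi> u\<close>, again a Pauli phase; higher levels follow through
  derivatives.\<close>

lemma phase_level_Suc: "f \<in> phase_level k \<Longrightarrow> f \<in> phase_level (Suc k)"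
proof (induction k arbitrary: f)
  case 0
  then obtain \<alpha> \<chi> where f: "\<alpha> \<in> unit_phases" "character \<chi>" "f = (\<lambda>x. \<alpha> * \<chi> x)"
    by (auto elim: pauli_phasesE)
  have "f (x XOR u) * cnj (f x) = (\<alpha> * cnj \<alpha>) * (\<chi> x * \<chi> x) * \<chi> u" for x u
    using f by (simp add: character_xor)
  then have "(\<lambda>x. f (x XOR u) * cnj (f x)) \<in> pauli_phases" for u
    using f by (simp add: unit_phases_mult_cnj pauli_phases_const character_unit_phase)
  then show ?case using 0 by (simp add: pauli_phases_mult_cnj)
next
  case (Suc k)
  then have "(\<lambda>x. f (x XOR u) * cnj (f x)) \<in> phase_level (Suc k)" for u
    by (intro Suc.IH) simp
  with Suc.prems show ?case by simp
qed

text \<open>Affine over the field with two elements; \<open>\<pi> u XOR \<pi> 0\<close> is the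
  linear part.\<close>

definition affine :: "(nat \<Rightarrow> nat) \<Rightarrow> bool" where
  "affine \<pi> \<longleftrightarrow> (\<forall>x u. \<pi> (x XOR u) = \<pi> x XOR (\<pi> u XOR \<pi> 0))"

lemma affineD: "affine \<pi> \<Longrightarrow> \<pi> (x XOR u) = \<pi> x XOR (\<pi> u XOR \<pi> 0)"
  by (simp add: affine_def)

lemma affine_xor: "affine (\<lambda>x. x XOR u)"
  by (auto simp: affine_def bit_eq_iff bit_xor_iff)

text \<open>The derivative of the composite along \<open>u\<close> is the derivative of
  \<open>f\<close> along \<open>\<pi> u XOR \<pi> 0\<close>, composed with \<pi>. At level 0, a
  character after an affine map is a character up to the sign
  \<open>\<chi> (\<pi> 0)\<close>.\<close>

lemma phase_level_affine:
  assumes "affine \<pi>"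
  shows "f \<in> phase_level k \<Longrightarrow> (\<lambda>x. f (\<pi> x)) \<in> phase_level k"
proof (induction k arbitrary: f)
  case 0
  then obtain \<alpha> \<chi> where f: "\<alpha> \<in> unit_phases" "character \<chi>" "f = (\<lambda>x. \<alpha> * \<chi> x)"
    by (auto elim: pauli_phasesE)
  have "\<chi> (\<pi> x) * \<chi> (\<pi> 0) \<in> {1, - 1}" for x
    using character_cases[OF f(2), of "\<pi> x"] character_cases[OF f(2), of "\<pi> 0"] by auto
  then have "character (\<lambda>x. \<chi> (\<pi> x) * \<chi> (\<pi> 0))"
    by (auto simp: character_def affineD[OF assms] character_xor[OF f(2)])
  moreover have "f (\<pi> x) = (\<alpha> * \<chi> (\<pi> 0)) * (\<chi> (\<pi> x) * \<chi> (\<pi> 0))" for x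
    using f character_square[OF f(2), of "\<pi> 0"] by (simp add: mult.assoc mult.left_commute)
  moreover have "\<alpha> * \<chi> (\<pi> 0) \<in> unit_phases"
    using f by (simp add: unit_phases_mult character_unit_phase)
  ultimately show ?case by (simp add: pauli_phasesI)
next
  case (Suc k)
  have "(\<lambda>x. f (\<pi> (x XOR u)) * cnj (f (\<pi> x))) \<in> phase_level k" for u
    unfolding affineD[OF assms]
    by (rule Suc.IH[of "\<lambda>y. f (y XOR (\<pi> u XOR \<pi> 0)) * cnj (f y)"]) (use Suc.prems in simp)
  with Suc.prems show ?case by simp
qed

text \<open>Conjugating a Pauli operator turns an affine \<pi> into a translation and
  \<open>f\<close> into a derivative times a Pauli phase, one level lower. The count starts at
  hierarchy level 2 because affine permutations are Clifford but in general not Pauli.\<close>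

lemma monomial_mat_clifford_hierarchy:
  assumes "index_involution n \<pi>" "affine \<pi>" "f \<in> phase_level (Suc k)"
  shows "monomial_mat n \<pi> f \<in> clifford_hierarchy n (Suc (Suc k))"
  using assms
proof (induction k arbitrary: \<pi> f)
  have *: "\<exists>w g. w < 2 ^ n \<and> g \<in> phase_level k \<and>
      conj_by (monomial_mat n \<pi> f) P = monomial_mat n (\<lambda>j. j XOR w) g"
    if \<pi>: "index_involution n \<pi>" "affine \<pi>" and f: "f \<in> phase_level (Suc k)"
      and P: "P \<in> pauli_operators n" for \<pi> f k P
  proof -
    obtain u h where h: "u < 2 ^ n" "h \<in> pauli_phases" "P = monomial_mat n (\<lambda>j. j XOR u) h"
      using P by (rule pauli_operatorsE)
    \<comment> \<open>Since \<pi> is an affine involution, \<open>\<pi> (\<pi> y XOR u)\<close> is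
      \<open>y XOR w\<close>; the phase of the conjugate at \<open>y\<close> is
      \<open>g (\<pi> y)\<close>.\<close>
    define w g where "w = \<pi> u XOR \<pi> 0" and "g = (\<lambda>x. (f (x XOR u) * cnj (f x)) * h x)"
    have "h \<in> phase_level k"
      using h(2) by (induction k) (use phase_level_Suc in auto)
    with f have "g \<in> phase_level k"
      unfolding g_def by (intro phase_level_mult[of "\<lambda>x. f (x XOR u) * cnj (f x)"]) auto
    then have "(\<lambda>y. g (\<pi> y)) \<in> phase_level k" by (rule phase_level_affine[OF \<pi>(2)])
    moreover have "w < 2 ^ n"
      using \<pi>(1) h(1) by (auto simp: w_def index_involution_def intro!: nat_xor_less)
    moreover have "conj_by (monomial_mat n \<pi> f) P = monomial_mat n (\<lambda>y. y XOR w) (\<lambda>y. g (\<pi> y))"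
      using \<pi> h(1) unfolding h(3)
      by (subst conj_by_monomial_mat)
        (auto simp: affineD w_def g_def index_involution_def ac_simps intro!: monomial_mat_cong)
    ultimately show ?thesis by blast
  qed
  have gate: "monomial_mat n \<pi> f \<in> qubit_gates n"
    if "index_involution n \<pi>" "f \<in> phase_level k" for \<pi> f k
    using that by (auto intro: monomial_mat_gate phase_level_mult_cnj)
  {
    case 0
    have "conj_by (monomial_mat n \<pi> f) P \<in> pauli_operators n"
      if P: "P \<in> pauli_operators n" for P
    proof -
      obtain w g where "w < 2 ^ n" "g \<in> phase_level 0"
          "conj_by (monomial_mat n \<pi> f) P = monomial_mat n (\<lambda>j. j XOR w) g"
        using *[OF 0 P] by blast
      then show ?thesis by (simp add: pauli_operatorsI)
    qed
    then show ?case
      using gate[OF 0(1,3)] by auto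
  next
    case (Suc k)
    have "conj_by (monomial_mat n \<pi> f) P \<in> clifford_hierarchy n (Suc (Suc k))"
      if P: "P \<in> pauli_operators n" for P
    proof -
      obtain w g where "w < 2 ^ n" "g \<in> phase_level (Suc k)"
          "conj_by (monomial_mat n \<pi> f) P = monomial_mat n (\<lambda>j. j XOR w) g"
        using *[OF Suc.prems P] by blast
      then show ?thesis
        by (simp only: Suc.IH[OF index_involution_xor affine_xor])
    qed
    then show ?case
      using gate[OF Suc.prems(1,3)] by auto
  }
qed

section \<open>Phases built from affine Boolean functions\<close>

definition affine_bit :: "(nat \<Rightarrow> bool) \<Rightarrow> bool" where
  "affine_bit p \<longleftrightarrow> (\<forall>x u. p (x XOR u) \<longleftrightarrow> (p x \<noteq> (p u \<noteq> p 0)))"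

lemma affine_bitD: "affine_bit p \<Longrightarrow> p (x XOR u) \<longleftrightarrow> (p x \<noteq> (p u \<noteq> p 0))"
  by (simp add: affine_bit_def)

lemma affine_bit_bit: "affine \<pi> \<Longrightarrow> affine_bit (\<lambda>x. bit (\<pi> x) m)"
  by (auto simp: affine_def affine_bit_def bit_xor_iff)

definition sign_phase :: "bool \<Rightarrow> complex" where
  "sign_phase b = (if b then - 1 else 1)"

definition quarter_phase :: "bool \<Rightarrow> complex" where
  "quarter_phase b = (if b then \<i> else 1)"

lemmas phase_defs = sign_phase_def quarter_phase_def

lemma phase_level_const: "\<alpha> \<in> unit_phases \<Longrightarrow> (\<lambda>x. \<alpha>) \<in> phase_level k"
  by (induction k) (simp add: pauli_phases_const, rule phase_level_Suc)

text \<open>The condition is constant in \<open>x\<close>; in use it records whether a bit changes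
  along the direction of a derivative.\<close>

lemma phase_level_if: "(b \<Longrightarrow> f \<in> phase_level k) \<Longrightarrow> (\<lambda>x. if b then f x else 1) \<in> phase_level k"
  using phase_level_const[of 1 k] by (cases b) (auto simp: unit_phases_def)

lemma sign_phase_affine_bit:
  assumes "affine_bit p" shows "(\<lambda>x. sign_phase (p x)) \<in> phase_level 0"
proof -
  have "character (\<lambda>x. sign_phase (p x \<noteq> p 0))"
    by (auto simp: character_def affine_bitD[OF assms] phase_defs)
  then have "(\<lambda>x. sign_phase (p x)) \<in> pauli_phases"
    by (rule pauli_phasesI[of "sign_phase (p 0)", rotated])
      (auto simp: phase_defs unit_phases_def)
  then show ?thesis by simp
qed

lemma phase_level_SucI:
  "(\<And>x. f x * cnj (f x) = 1) \<Longrightarrow> (\<And>u. (\<lambda>x. f (x XOR u) * cnj (f x)) \<in> phase_level k) \<Longrightarrow>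
   f \<in> phase_level (Suc k)"
  by simp

text \<open>If p' and q' are the changes of p and q along \<open>u\<close>, the derivative of
  (-1)^(pq) has the affine exponent p q' + q p' + p' q'.\<close>

lemma sign_phase_conj:
  assumes p: "affine_bit p" and q: "affine_bit q"
  shows "(\<lambda>x. sign_phase (p x \<and> q x)) \<in> phase_level (Suc 0)"
proof (rule phase_level_SucI)
  fix u
  have "(\<lambda>x. sign_phase (p (x XOR u) \<and> q (x XOR u)) * cnj (sign_phase (p x \<and> q x))) =
     (\<lambda>x. (if q u \<noteq> q 0 then sign_phase (p x) else 1) * ((if p u \<noteq> p 0 then sign_phase (q x) else 1) *
       sign_phase ((p u \<noteq> p 0) \<and> (q u \<noteq> q 0))))"
    by (rule ext) (auto simp: affine_bitD[OF p] affine_bitD[OF q] phase_defs)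
  also have "\<dots> \<in> phase_level 0"
    by (intro phase_level_mult phase_level_if phase_level_const sign_phase_affine_bit p q)
      (simp add: unit_phases_def phase_defs)
  finally show "(\<lambda>x. sign_phase (p (x XOR u) \<and> q (x XOR u)) * cnj (sign_phase (p x \<and> q x))) \<in> phase_level 0" .
qed (simp add: phase_defs)

text \<open>Where \<open>p\<close> changes along \<open>u\<close>, the derivative is i^(1 - 2p) = i
  (-1)^p; otherwise it is 1.\<close>

lemma quarter_phase_affine_bit:
  assumes p: "affine_bit p" shows "(\<lambda>x. quarter_phase (p x)) \<in> phase_level (Suc 0)"
proof (rule phase_level_SucI)
  fix u
  have "(\<lambda>x. quarter_phase (p (x XOR u)) * cnj (quarter_phase (p x))) =
     (\<lambda>x. (if p u \<noteq> p 0 then sign_phase (p x) else 1) * quarter_phase (p u \<noteq> p 0))"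
    by (rule ext) (auto simp: affine_bitD[OF p] phase_defs)
  also have "\<dots> \<in> phase_level 0"
    by (intro phase_level_mult phase_level_if phase_level_const sign_phase_affine_bit p)
      (simp add: unit_phases_def phase_defs)
  finally show "(\<lambda>x. quarter_phase (p (x XOR u)) * cnj (quarter_phase (p x))) \<in> phase_level 0" .
qed (simp add: phase_defs)

text \<open>Exponents are integers here, and a change of p replaces p by 1 - p. A change of p alone
  gives i^(q - 2pq) = i^q (-1)^(pq), a change of both gives i^(1 - p - q); all these factors have
  level 1.\<close>

lemma quarter_phase_conj:
  assumes p: "affine_bit p" and q: "affine_bit q"
  shows "(\<lambda>x. quarter_phase (p x \<and> q x)) \<in> phase_level (Suc (Suc 0))"
proof (rule phase_level_SucI)
  fix u
  let ?D = "\<lambda>x. quarter_phase (p (x XOR u) \<and> q (x XOR u)) * cnj (quarter_phase (p x \<and> q x))"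
  note lev = quarter_phase_affine_bit[OF p] quarter_phase_affine_bit[OF q] sign_phase_conj[OF p q]
  show "?D \<in> phase_level (Suc 0)"
  proof -
    consider "p u = p 0" "q u = q 0" | "p u \<noteq> p 0" "q u = q 0" | "p u = p 0" "q u \<noteq> q 0"
      | "p u \<noteq> p 0" "q u \<noteq> q 0" by blast
    then show ?thesis
    proof cases
      case 1
      then have "?D = (\<lambda>x. 1)"
        by (intro ext) (auto simp: affine_bitD[OF p] affine_bitD[OF q] phase_defs)
      then show ?thesis using phase_level_const[of 1 "Suc 0"] by (simp del: phase_level.simps add: unit_phases_def)
    next
      case 2
      then have "?D = (\<lambda>x. quarter_phase (q x) * sign_phase (p x \<and> q x))"
        by (intro ext) (auto simp: affine_bitD[OF p] affine_bitD[OF q] phase_defs)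
      then show ?thesis using phase_level_mult[OF lev(2,3)] by (simp only:)
    next
      case 3
      then have "?D = (\<lambda>x. quarter_phase (p x) * sign_phase (p x \<and> q x))"
        by (intro ext) (auto simp: affine_bitD[OF p] affine_bitD[OF q] phase_defs)
      then show ?thesis using phase_level_mult[OF lev(1,3)] by (simp only:)
    next
      case 4
      then have "?D = (\<lambda>x. \<i> * (cnj (quarter_phase (p x)) * cnj (quarter_phase (q x))))"
        by (intro ext) (auto simp: affine_bitD[OF p] affine_bitD[OF q] phase_defs)
      then show ?thesis
        using phase_level_mult[OF phase_level_const
            phase_level_mult[OF lev(1)[THEN phase_level_cnj] lev(2)[THEN phase_level_cnj]], of \<i>]
        by (simp only: unit_phases_def insert_iff simp_thms)
    qed
  qed
qed (simp add: phase_defs)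

section \<open>The counterexample\<close>

text \<open>Bits are counted from the least significant one, so bits 0, 1 and 2 belong to the last
  three tensor factors; 4 is the mask of bit 2.\<close>

definition toffoli :: "nat \<Rightarrow> nat" where
  "toffoli x = x XOR (if bit x 0 \<and> bit x 1 then 4 else 0)"

lemma bit_four_iff: "bit (4 :: nat) m \<longleftrightarrow> m = 2"
  using bit_exp_iff[where ?'a = nat, of 2 m] by auto

lemma bit_toffoli: "bit (toffoli x) m \<longleftrightarrow> (bit x m \<noteq> (m = 2 \<and> bit x 0 \<and> bit x 1))"
  by (simp add: toffoli_def bit_xor_iff bit_four_iff)

lemma index_involution_toffoli:
  assumes "n > 2" shows "index_involution n toffoli"
proof -
  have "(4 :: nat) < 2 ^ n" using power_strict_increasing[OF assms, of "2 :: nat"] by simp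
  then have "x < 2 ^ n \<Longrightarrow> toffoli x < 2 ^ n" for x
    by (simp add: toffoli_def nat_xor_less)
  moreover have "toffoli (toffoli x) = x" for x
    by (rule bit_eqI) (auto simp: bit_toffoli)
  ultimately show ?thesis by (simp add: index_involution_def)
qed

abbreviation toffoli_conj :: "nat \<Rightarrow> nat \<Rightarrow> nat" where
  "toffoli_conj u y \<equiv> toffoli (toffoli y XOR u)"

text \<open>In bit 2 the two Toffoli maps add y0 y1 and (y0 + u0)(y1 + u1). The quadratic terms
  cancel, leaving u0 u1 + u0 y1 + y0 u1, which is affine in \<open>y\<close>.\<close>

lemma bit_toffoli_conj:
  "bit (toffoli_conj u y) m \<longleftrightarrow> (bit y m \<noteq> (bit u m \<noteq>
     (m = 2 \<and> ((bit u 0 \<and> bit u 1) \<noteq> ((bit u 0 \<and> bit y 1) \<noteq> (bit y 0 \<and> bit u 1))))))"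
  by (auto simp: bit_toffoli bit_xor_iff)

lemma affine_toffoli_conj: "affine (toffoli_conj u)"
  unfolding affine_def by (intro allI bit_eqI) (auto simp: bit_toffoli_conj bit_xor_iff)

lemma index_involution_toffoli_conj:
  assumes "n > 2" "u < 2 ^ n" shows "index_involution n (toffoli_conj u)"
  using index_involution_toffoli[OF assms(1)] assms(2)
  by (simp add: index_involution_def nat_xor_less)

text \<open>A Toffoli gate followed by the controlled phase gate diag(1, 1, 1, i) on bits 0 and 2.
  Since \<open>monomial_mat\<close> reads phases at the input, the output is written as
  \<open>toffoli x\<close>.\<close>

definition counterexample_gate :: "nat \<Rightarrow> complex mat" where
  "counterexample_gate n = monomial_mat n toffoli
     (\<lambda>x. quarter_phase (bit (toffoli x) 0 \<and> bit (toffoli x) 2))"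

text \<open>From right to left: the phases of the adjoint gate, the Pauli operator and the gate
  along the path of \<open>y\<close>.\<close>

definition conj_phase :: "nat \<Rightarrow> (nat \<Rightarrow> complex) \<Rightarrow> nat \<Rightarrow> complex" where
  "conj_phase u f y = quarter_phase (bit (toffoli_conj u y) 0 \<and> bit (toffoli_conj u y) 2) *
     f (toffoli y) * cnj (quarter_phase (bit y 0 \<and> bit y 2))"

lemma conj_by_counterexample_gate:
  assumes "n > 2" "u < 2 ^ n"
  shows "conj_by (counterexample_gate n) (monomial_mat n (\<lambda>j. j XOR u) f) =
    monomial_mat n (toffoli_conj u) (conj_phase u f)"
  using index_involution_toffoli[OF assms(1)] assms(2)
  unfolding counterexample_gate_def
  by (subst conj_by_monomial_mat) (auto simp: conj_phase_def index_involution_def intro!: monomial_mat_cong)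

lemma conj_phase_level:
  assumes "f \<in> pauli_phases" shows "conj_phase u f \<in> phase_level (Suc (Suc 0))"
proof -
  obtain \<alpha> \<chi> where f: "\<alpha> \<in> unit_phases" "character \<chi>" "f = (\<lambda>x. \<alpha> * \<chi> x)"
    using assms by (rule pauli_phasesE)
  have bits: "affine_bit (\<lambda>x. bit x m)" for m
    by (simp add: affine_bit_def bit_xor_iff)
  \<comment> \<open>Flipping bit 2 multiplies \<open>f\<close> by \<open>\<chi> 4\<close>, so
    \<open>\<chi> 4 = - 1\<close> contributes the quadratic sign (-1)^(y0 y1).\<close>
  have "f (toffoli y) = f y * (if \<chi> 4 = - 1 then sign_phase (bit y 0 \<and> bit y 1) else 1)" for y
    using f character_cases[OF f(2), of 4] by (auto simp: toffoli_def phase_defs character_xor)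
  moreover have "(\<lambda>y. if \<chi> 4 = - 1 then sign_phase (bit y 0 \<and> bit y 1) else 1) \<in> phase_level (Suc (Suc 0))"
    by (intro phase_level_if phase_level_Suc[OF sign_phase_conj] bits)
  moreover have "f \<in> phase_level (Suc (Suc 0))"
    using assms phase_level_Suc[OF phase_level_Suc, of f 0] by (simp only: phase_level.simps(1))
  ultimately have "(\<lambda>y. f (toffoli y)) \<in> phase_level (Suc (Suc 0))"
    using phase_level_mult by (simp del: phase_level.simps)
  moreover have "(\<lambda>y. quarter_phase (bit (toffoli_conj u y) 0 \<and> bit (toffoli_conj u y) 2)) \<in> phase_level (Suc (Suc 0))"
    by (intro quarter_phase_conj affine_bit_bit affine_toffoli_conj)
  moreover have "(\<lambda>y. cnj (quarter_phase (bit y 0 \<and> bit y 2))) \<in> phase_level (Suc (Suc 0))"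
    by (intro phase_level_cnj quarter_phase_conj bits)
  ultimately show ?thesis
    unfolding conj_phase_def by (intro phase_level_mult)
qed

lemma counterexample_gate_unitary:
  assumes "n > 2" shows "counterexample_gate n \<in> qubit_gates n"
  unfolding counterexample_gate_def
  by (rule monomial_mat_gate[OF index_involution_toffoli[OF assms]]) (simp add: phase_defs)

text \<open>\<open>toffoli\<close> is quadratic, so the affine criterion is applied to the
  conjugates of Pauli operators: an affine permutation with a level 2 phase lies at hierarchy level
  3.\<close>

lemma counterexample_gate_level_four:
  assumes "n > 2" shows "counterexample_gate n \<in> clifford_hierarchy n 4"
proof -
  have "conj_by (counterexample_gate n) P \<in> clifford_hierarchy n (Suc (Suc 1))"
    if P: "P \<in> pauli_operators n" for P
  proof -
    obtain u f where f: "u < 2 ^ n" "f \<in> pauli_phases" "P = monomial_mat n (\<lambda>j. j XOR u) f"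
      using P by (rule pauli_operatorsE)
    show ?thesis
      unfolding f(3) conj_by_counterexample_gate[OF assms f(1)]
      by (intro monomial_mat_clifford_hierarchy index_involution_toffoli_conj assms f(1)
          affine_toffoli_conj) (use conj_phase_level[OF f(2)] in \<open>simp only: One_nat_def\<close>)
  qed
  then have "counterexample_gate n \<in> clifford_hierarchy n (Suc (Suc (Suc 1)))"
    using counterexample_gate_unitary[OF assms] by auto
  moreover have "4 = Suc (Suc (Suc 1))" by simp
  ultimately show ?thesis by (simp only:)
qed

section \<open>Pauli operators with Pauli conjugates\<close>

definition pauli_Z_bit2 :: "nat \<Rightarrow> complex mat" where
  "pauli_Z_bit2 n = monomial_mat n (\<lambda>j. j XOR 0) (\<lambda>j. sign_phase (bit j 2))"

lemma sign_phase_bit2: "(\<lambda>j. sign_phase (bit j 2)) \<in> pauli_phases"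
  using sign_phase_affine_bit[of "\<lambda>j. bit j 2"] by (simp add: affine_bit_def bit_xor_iff)

lemma pauli_Z_bit2_pauli: "pauli_Z_bit2 n \<in> pauli_operators n"
  unfolding pauli_Z_bit2_def by (rule pauli_operatorsI) (auto simp: sign_phase_bit2)

lemma bit_small:
  "bit (Suc 0) m \<longleftrightarrow> m = 0" "bit (2 :: nat) m \<longleftrightarrow> m = 1" "bit (3 :: nat) m \<longleftrightarrow> m = 0 \<or> m = 1"
  using bit_exp_iff[where ?'a = nat, of 0 m] bit_exp_iff[where ?'a = nat, of 1 m]
    bit_xor_iff[of "1 :: nat" 2 m] by auto

text \<open>Columns are compared with the normal form of a Pauli operator; their entries are nonzero
  because the phases have modulus one. Indices below 4 let bits 0 and 1 vary while bit 2 is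
  clear.\<close>

lemma counterexample_gate_pauli_image:
  assumes n: "n > 2" and u: "u < 2 ^ n" and f: "f \<in> pauli_phases"
    and image: "conj_by (counterexample_gate n) (monomial_mat n (\<lambda>j. j XOR u) f) \<in> pauli_operators n"
  obtains v \<beta> \<psi> where "character \<psi>" "\<beta> \<in> unit_phases"
    "\<And>j. j < 4 \<Longrightarrow> toffoli_conj u j = j XOR v \<and> conj_phase u f j = \<beta> * \<psi> j"
proof -
  obtain v g where g: "g \<in> pauli_phases"
      "monomial_mat n (toffoli_conj u) (conj_phase u f) = monomial_mat n (\<lambda>j. j XOR v) g"
    using image pauli_operatorsE unfolding conj_by_counterexample_gate[OF n u] by metis
  obtain \<beta> \<psi> where \<psi>: "\<beta> \<in> unit_phases" "character \<psi>" "g = (\<lambda>x. \<beta> * \<psi> x)"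
    using g(1) by (rule pauli_phasesE)
  show thesis
  proof (rule that[OF \<psi>(2,1)])
    fix j :: nat assume "j < 4"
    moreover have "(4 :: nat) < 2 ^ n" using power_strict_increasing[OF n, of "2 :: nat"] by simp
    ultimately have "j < 2 ^ n" by simp
    moreover from this have "toffoli_conj u j < 2 ^ n"
      using index_involution_toffoli_conj[OF n u] by (simp add: index_involution_def)
    moreover have "conj_phase u f j \<noteq> 0"
      using phase_level_mult_cnj[OF conj_phase_level[OF f], of u j] by force
    ultimately show "toffoli_conj u j = j XOR v \<and> conj_phase u f j = \<beta> * \<psi> j"
      using monomial_mat_eqD[OF g(2)] \<psi>(3) by simp
  qed
qed

lemma pauli_image_commutes:
  assumes n: "n > 2" and P: "P \<in> pauli_operators n"
    and image: "conj_by (counterexample_gate n) P \<in> pauli_operators n"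
  shows "P * pauli_Z_bit2 n = pauli_Z_bit2 n * P"
proof -
  obtain u f where f: "u < 2 ^ n" "f \<in> pauli_phases" "P = monomial_mat n (\<lambda>j. j XOR u) f"
    using P by (rule pauli_operatorsE)
  obtain v \<beta> \<psi> where \<psi>: "character \<psi>" "\<beta> \<in> unit_phases"
      and eq: "\<And>j. j < 4 \<Longrightarrow> toffoli_conj u j = j XOR v \<and> conj_phase u f j = \<beta> * \<psi> j"
    using counterexample_gate_pauli_image[OF n f(1,2)] image f(3) by metis
  have "bit (toffoli_conj u j) 2 \<longleftrightarrow> bit (j XOR v) 2" if "j < 4" for j
    using eq[OF that] by simp
  \<comment> \<open>A translation changes bit 2 independently of the other bits: comparing
    \<open>j = 1\<close> with \<open>j = 0\<close> clears bit 1 of \<open>u\<close>, and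
    \<open>j = 2\<close> clears bit 0.\<close>
  from this[of 0] this[of 1] this[of 2] have u01: "\<not> bit u 0" "\<not> bit u 1"
    unfolding bit_toffoli_conj bit_xor_iff by (auto simp: bit_small)
  have "\<not> bit u 2"
  proof
    assume u2: "bit u 2"
    obtain \<alpha> \<chi> where \<chi>: "\<alpha> \<in> unit_phases" "character \<chi>" "f = (\<lambda>x. \<alpha> * \<chi> x)"
      using f(2) by (rule pauli_phasesE)
    \<comment> \<open>With bit 2 flipped, column 1 acquires the controlled phase i and column 0 does
      not. Their ratio \<open>\<i> * \<chi> 1\<close> is not real, whereas \<open>\<psi> 1\<close>
      is a sign.\<close>
    have "conj_phase u f 0 = \<alpha>" "conj_phase u f 1 = \<i> * (\<alpha> * \<chi> 1)"
      using \<chi> u01 u2 unfolding conj_phase_def bit_toffoli_conj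
      by (simp_all add: bit_small phase_defs toffoli_def)
    with eq[of 0] eq[of 1] \<psi> \<chi> have "\<i> * \<chi> 1 = \<psi> 1" "\<alpha> \<noteq> 0"
      by (auto simp: unit_phases_def)
    then show False
      using character_cases[OF \<chi>(2), of 1] character_cases[OF \<psi>(1), of 1]
      by (auto simp: complex_eq_iff)
  qed
  \<comment> \<open>The translation by \<open>u\<close> preserves bit 2, hence the sign given by
    Z.\<close>
  then show ?thesis
    unfolding f(3) pauli_Z_bit2_def using f(1)
    by (auto simp: monomial_mat_mult nat_xor_less bit_xor_iff mult.commute intro!: monomial_mat_cong)
qed

text \<open>For shift 0 the quarter phases cancel, leaving the sign of bit 2 after the Toffoli map.
  On indices below 4 this is (-1)^(j0 j1), which fails multiplicativity at 3 = 1 XOR 2.\<close>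

lemma pauli_Z_bit2_image:
  assumes n: "n > 2"
  shows "conj_by (counterexample_gate n) (pauli_Z_bit2 n) \<notin> pauli_operators n"
proof
  let ?f = "\<lambda>j :: nat. sign_phase (bit j 2)"
  assume "conj_by (counterexample_gate n) (pauli_Z_bit2 n) \<in> pauli_operators n"
  then obtain v \<beta> \<psi> where \<psi>: "character \<psi>" "\<beta> \<in> unit_phases"
      and "\<And>j. j < 4 \<Longrightarrow> toffoli_conj 0 j = j XOR v \<and> conj_phase 0 ?f j = \<beta> * \<psi> j"
    using counterexample_gate_pauli_image[OF n, of 0 ?f] sign_phase_bit2
    unfolding pauli_Z_bit2_def by (metis zero_less_numeral zero_less_power)
  then have eq: "conj_phase 0 ?f j = \<beta> * \<psi> j" if "j < 4" for j
    using that by blast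
  have "conj_phase 0 ?f 0 = 1" "conj_phase 0 ?f 1 = 1" "conj_phase 0 ?f 2 = 1" "conj_phase 0 ?f 3 = - 1"
    unfolding conj_phase_def bit_toffoli_conj by (simp_all add: bit_toffoli bit_small phase_defs)
  with eq[of 0] eq[of 1] eq[of 2] eq[of 3] \<psi>
  have "\<beta> = 1" "\<psi> 1 = 1" "\<psi> 2 = 1" "\<psi> 3 = - 1" by auto
  moreover have "\<psi> 3 = \<psi> 1 * \<psi> 2"
    using character_xor[OF \<psi>(1), of 1 2] by simp
  ultimately show False by simp
qed

section \<open>Maximal abelian subgroups\<close>

definition centralizer_in :: "('a, 'b) monoid_scheme \<Rightarrow> 'a set \<Rightarrow> 'a set" where
  "centralizer_in G S = {x \<in> carrier G. \<forall>s \<in> S. x \<otimes>\<^bsub>G\<^esub> s = s \<otimes>\<^bsub>G\<^esub> x}"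

context group
begin

lemma subgroup_centralizer_in:
  assumes "S \<subseteq> carrier G" shows "subgroup (centralizer_in G S) G"
proof (rule subgroupI)
  show "centralizer_in G S \<noteq> {}"
    using assms by (auto simp: centralizer_in_def intro!: exI[of _ \<one>])
next
  fix a assume a: "a \<in> centralizer_in G S"
  have "inv a \<otimes> s = s \<otimes> inv a" if "s \<in> S" for s
  proof -
    have s: "s \<in> carrier G" "a \<in> carrier G" "a \<otimes> s = s \<otimes> a"
      using a that assms by (auto simp: centralizer_in_def)
    have "inv a \<otimes> s = inv a \<otimes> (s \<otimes> a) \<otimes> inv a"
      using s(1,2) by (simp add: m_assoc)
    also have "\<dots> = inv a \<otimes> (a \<otimes> s) \<otimes> inv a"
      by (simp only: s(3))
    also have "\<dots> = s \<otimes> inv a"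
      using s(1,2) by (simp flip: m_assoc)
    finally show ?thesis .
  qed
  then show "inv a \<in> centralizer_in G S"
    using a by (auto simp: centralizer_in_def)
next
  fix a b assume ab: "a \<in> centralizer_in G S" "b \<in> centralizer_in G S"
  have "a \<otimes> b \<otimes> s = s \<otimes> (a \<otimes> b)" if "s \<in> S" for s
  proof -
    have "a \<in> carrier G" "b \<in> carrier G" "s \<in> carrier G" "a \<otimes> s = s \<otimes> a" "b \<otimes> s = s \<otimes> b"
      using ab that assms by (auto simp: centralizer_in_def)
    then show ?thesis by (metis m_assoc)
  qed
  then show "a \<otimes> b \<in> centralizer_in G S"
    using ab by (auto simp: centralizer_in_def)
qed (auto simp: centralizer_in_def)

text \<open>Centralizers are subgroups, so commutation passes from generators to the generated
  subgroup, first in one argument and then in the other.\<close>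

lemma abelian_subgroup_generate:
  assumes S: "S \<subseteq> carrier G" and comm: "\<And>x y. x \<in> S \<Longrightarrow> y \<in> S \<Longrightarrow> x \<otimes> y = y \<otimes> x"
  shows "abelian_subgroup (generate G S) G"
proof -
  have sub: "subgroup (generate G S) G" by (rule generate_is_subgroup[OF S])
  have "S \<subseteq> centralizer_in G S" using S comm by (auto simp: centralizer_in_def)
  then have "generate G S \<subseteq> centralizer_in G S"
    by (rule generate_subgroup_incl[OF _ subgroup_centralizer_in[OF S]])
  then have "S \<subseteq> centralizer_in G (generate G S)"
    using S by (fastforce simp: centralizer_in_def)
  then have "generate G S \<subseteq> centralizer_in G (generate G S)"
    by (rule generate_subgroup_incl[OF _ subgroup_centralizer_in[OF subgroup.subset[OF sub]]])
  then have "comm_group (G\<lparr>carrier := generate G S\<rparr>)"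
    by (intro group.group_comm_groupI[OF subgroup.subgroup_is_group[OF sub group_axioms]])
      (auto simp: centralizer_in_def)
  with sub show ?thesis by (simp add: abelian_subgroup_def)
qed

text \<open>Adjoining \<open>q\<close> and generating gives an abelian subgroup containing
  \<open>H\<close>, which by maximality is \<open>H\<close> itself.\<close>

lemma maximal_abelian_subgroup_mem:
  assumes H: "maximal_abelian_subgroup H G" and q: "q \<in> carrier G"
    and comm: "\<And>h. h \<in> H \<Longrightarrow> h \<otimes> q = q \<otimes> h"
  shows "q \<in> H"
proof -
  have sub: "subgroup H G" and cg: "comm_group (G\<lparr>carrier := H\<rparr>)"
    using H by (auto simp: maximal_abelian_subgroup_def abelian_subgroup_def)
  have "x \<otimes> y = y \<otimes> x" if "x \<in> H" "y \<in> H" for x y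
    using comm_groupE(4)[OF cg] that by simp
  then have "abelian_subgroup (generate G (insert q H)) G"
    using q comm subgroup.subset[OF sub] by (intro abelian_subgroup_generate) auto
  moreover have "insert q H \<subseteq> generate G (insert q H)"
    by (auto intro: generate.incl)
  ultimately show ?thesis
    using H unfolding maximal_abelian_subgroup_def by blast
qed

end

lemma counterexample_gate_not_semi_clifford:
  assumes n: "n > 2" shows "\<not> semi_clifford n (counterexample_gate n)"
proof
  assume "semi_clifford n (counterexample_gate n)"
  then obtain G where G: "maximal_abelian_subgroup G (pauli_group n)"
      "maximal_abelian_subgroup (conj_by (counterexample_gate n) ` G) (pauli_group n)"
    unfolding semi_clifford_def by blast
  then have sub: "G \<subseteq> pauli_operators n" "conj_by (counterexample_gate n) ` G \<subseteq> pauli_operators n"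
    using subgroup.subset carrier_pauli_group
    unfolding maximal_abelian_subgroup_def abelian_subgroup_def by metis+
  have "pauli_Z_bit2 n \<in> G"
  proof (rule group.maximal_abelian_subgroup_mem[OF group_pauli_group G(1)])
    fix P assume "P \<in> G"
    with sub show "P \<otimes>\<^bsub>pauli_group n\<^esub> pauli_Z_bit2 n = pauli_Z_bit2 n \<otimes>\<^bsub>pauli_group n\<^esub> P"
      by (simp add: pauli_image_commutes[OF n] image_subset_iff subset_iff)
  qed (simp add: pauli_Z_bit2_pauli)
  with sub(2) pauli_Z_bit2_image[OF n] show False by blast
qed

theorem theorem3:
  fixes n k :: nat
  assumes "n > 2" and "k > 3"
  shows "\<exists>U. U \<in> qubit_gates n \<and> U \<in> clifford_hierarchy n k \<and> \<not> semi_clifford n U"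
proof (intro exI conjI)
  show "counterexample_gate n \<in> qubit_gates n"
    by (rule counterexample_gate_unitary[OF assms(1)])
  show "counterexample_gate n \<in> clifford_hierarchy n k"
    using counterexample_gate_level_four[OF assms(1)] clifford_hierarchy_mono[of 4 k n] assms(2)
    by auto
  show "\<not> semi_clifford n (counterexample_gate n)"
    by (rule counterexample_gate_not_semi_clifford[OF assms(1)])
qed

end
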